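(* Let $\alpha,\beta,\gamma$ be nonzero real numbers and let $n\ge 3$ be an integer. Define the sequence $a(m)=a(\alpha,\beta,\gamma;m)$, $m\ge 3$, by $$a(3)=\alpha^3+\beta^3+\gamma^3+3\alpha\beta\gamma,\qquad a(4)=\alpha^4+\beta^4+\gamma^4+4\alpha\beta^2\gamma+2(\alpha\gamma)^2,$$ $$a(m)=\beta a(m-1)+\alpha\gamma a(m-2)+\alpha^{m-1}(\alpha-\beta-\gamma)+\gamma^{m-1}(\gamma-\beta-\alpha),\quad m\ge 5.$$ Let $R(n;3)$ be the set of all partitions of $n$ into parts each at least $3$, and for $r\in R(n;3)$, $r: n=n_1+\dots+n_k$, put $H_{\alpha,\beta,\gamma}(r)=\prod_{i=1}^{k}a(n_i)$. Then the set of all values taken by the permanent on $\widehat{\Lambda}_n(\alpha,\beta,\gamma)$ is $$ps[\widehat{\Lambda}_n(\alpha,\beta,\gamma)]=\{H_{\alpha,\beta,\gamma}(r): r\in R(n;3)\}.$$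
   Context: $\Lambda_n(\alpha,\beta,\gamma)$ is the class of $n\times n$ matrices containing each of $\alpha,\beta,\gamma$ exactly once in each row and in each column, all other entries being $0$ (i.e. matrices $\alpha A+\beta B+\gamma C$ with $A,B,C$ permutation matrices with pairwise disjoint supports; this also covers the case when some of $\alpha,\beta,\gamma$ coincide). $\widehat{\Lambda}_n(\alpha,\beta,\gamma)$ is the subclass of those matrices with $\beta$'s on the main diagonal and with symmetric positions of $\alpha$ and $\gamma$ ($\alpha$ is placed at position $(i,j)$ if and only if $\gamma$ is placed at position $(j,i)$); equivalently, the set of matrices $\alpha S^{-1}+\beta I_n+\gamma S$, where $S$ is the permutation matrix of a permutation of $\{1,\dots,n\}$ all of whose cycles have length at least $3$. For a class of matrices $\mathcal{C}$, $ps[\mathcal{C}]$ denotes the set of all values of the permanent on $\mathcal{C}$. *)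

theory Defs
  imports "Jordan_Normal_Form.Determinant" "HOL-Library.Multiset"
begin

text \<open>Matrices of order \<open>n\<close> have row and column indices \<open>0, \<dots>, n - 1\<close>.\<close>

definition permanent :: "'a::comm_ring_1 mat \<Rightarrow> 'a" where
  "permanent M =
     (\<Sum>p | p permutes {0..<dim_row M}. \<Prod>i = 0..<dim_row M. M $$ (i, p i))"

definition permutation_matrix :: "nat \<Rightarrow> real mat \<Rightarrow> bool" where
  "permutation_matrix n P \<longleftrightarrow>
     P \<in> carrier_mat n n \<and>
     (\<forall>i<n. \<forall>j<n. P $$ (i, j) \<in> {0, 1}) \<and>
     (\<forall>i<n. \<exists>!j. j < n \<and> P $$ (i, j) = 1) \<and>
     (\<forall>j<n. \<exists>!i. i < n \<and> P $$ (i, j) = 1)"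

definition disjoint_supports :: "nat \<Rightarrow> real mat \<Rightarrow> real mat \<Rightarrow> bool" where
  "disjoint_supports n P Q \<longleftrightarrow> (\<forall>i<n. \<forall>j<n. P $$ (i, j) = 0 \<or> Q $$ (i, j) = 0)"

text \<open>
  A placement \<open>(A, B, C)\<close> records the positions of \<open>\<alpha>\<close>, \<open>\<beta>\<close> and \<open>\<gamma>\<close>. Speaking of
  positions rather than of values keeps the classes below meaningful when some of \<open>\<alpha>\<close>, \<open>\<beta>\<close>,
  \<open>\<gamma>\<close> coincide.
\<close>

definition placement :: "nat \<Rightarrow> real mat \<Rightarrow> real mat \<Rightarrow> real mat \<Rightarrow> bool" where
  "placement n A B C \<longleftrightarrow>
     permutation_matrix n A \<and> permutation_matrix n B \<and> permutation_matrix n C \<and>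
     disjoint_supports n A B \<and> disjoint_supports n A C \<and> disjoint_supports n B C"

definition Lambda :: "nat \<Rightarrow> real \<Rightarrow> real \<Rightarrow> real \<Rightarrow> real mat set" where
  "Lambda n \<alpha> \<beta> \<gamma> = {\<alpha> \<cdot>\<^sub>m A + \<beta> \<cdot>\<^sub>m B + \<gamma> \<cdot>\<^sub>m C | A B C. placement n A B C}"

definition Lambda_hat :: "nat \<Rightarrow> real \<Rightarrow> real \<Rightarrow> real \<Rightarrow> real mat set" where
  "Lambda_hat n \<alpha> \<beta> \<gamma> =
     {\<alpha> \<cdot>\<^sub>m A + \<beta> \<cdot>\<^sub>m B + \<gamma> \<cdot>\<^sub>m C | A B C. placement n A B C \<and>
        (\<forall>i<n. B $$ (i, i) = 1) \<and>
        (\<forall>i<n. \<forall>j<n. A $$ (i, j) = 1 \<longleftrightarrow> C $$ (j, i) = 1)}"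

lemma Lambda_hat_subset: "Lambda_hat n \<alpha> \<beta> \<gamma> \<subseteq> Lambda n \<alpha> \<beta> \<gamma>"
  unfolding Lambda_hat_def Lambda_def by blast

definition ps :: "real mat set \<Rightarrow> real set" where
  "ps \<C> = permanent ` \<C>"

text \<open>The values at \<open>m < 3\<close> are dummies and do not enter the values at \<open>m \<ge> 3\<close>.\<close>

fun a_seq :: "real \<Rightarrow> real \<Rightarrow> real \<Rightarrow> nat \<Rightarrow> real" where
  "a_seq \<alpha> \<beta> \<gamma> m =
    (if m < 3 then 0
     else if m = 3 then \<alpha> ^ 3 + \<beta> ^ 3 + \<gamma> ^ 3 + 3 * \<alpha> * \<beta> * \<gamma>
     else if m = 4 then \<alpha> ^ 4 + \<beta> ^ 4 + \<gamma> ^ 4 + 4 * \<alpha> * \<beta>\<^sup>2 * \<gamma> + 2 * (\<alpha> * \<gamma>)\<^sup>2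
     else \<beta> * a_seq \<alpha> \<beta> \<gamma> (m - 1) + \<alpha> * \<gamma> * a_seq \<alpha> \<beta> \<gamma> (m - 2)
          + \<alpha> ^ (m - 1) * (\<alpha> - \<beta> - \<gamma>) + \<gamma> ^ (m - 1) * (\<gamma> - \<beta> - \<alpha>))"

declare a_seq.simps [simp del]

definition R :: "nat \<Rightarrow> nat \<Rightarrow> nat multiset set" where
  "R n k = {r. sum_mset r = n \<and> (\<forall>m \<in># r. k \<le> m)}"

definition H :: "real \<Rightarrow> real \<Rightarrow> real \<Rightarrow> nat multiset \<Rightarrow> real" where
  "H \<alpha> \<beta> \<gamma> r = (\<Prod>m \<in># r. a_seq \<alpha> \<beta> \<gamma> m)"

end

theory Submission
  imports Defs
begin

text \<open>
  A matrix of \<open>Lambda_hat\<close> is \<open>\<alpha> S\<^sup>-\<^sup>1 + \<beta> I + \<gamma> S\<close> for a permutation without cycles of length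
  at most 2. The cycles split it into diagonal blocks, so its permanent is the product of the
  permanents of the blocks, and every partition of \<open>n\<close> into parts at least 3 is a cycle type. A
  cycle of length \<open>m\<close> gives a cyclic tridiagonal block; expanding its permanent along the last row
  yields \<open>\<alpha>\<^sup>m + \<gamma>\<^sup>m + \<beta> T\<^sub>m\<^sub>-\<^sub>1 + 2 \<alpha> \<gamma> T\<^sub>m\<^sub>-\<^sub>2\<close>, where \<open>T\<^sub>k\<close> is the permanent of the ordinary
  tridiagonal matrix of order \<open>k\<close>. Since \<open>T\<^sub>k = \<beta> T\<^sub>k\<^sub>-\<^sub>1 + \<alpha> \<gamma> T\<^sub>k\<^sub>-\<^sub>2\<close>, this sequence satisfies the
  recurrence of \<open>a_seq\<close>.
\<close>

section \<open>Permanents over arbitrary finite index sets\<close>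

text \<open>Extensionality fixes the values outside \<open>X\<close>, so each bijection is counted
  exactly once.\<close>

definition bijections :: "'a set \<Rightarrow> 'b set \<Rightarrow> ('a \<Rightarrow> 'b) set" where
  "bijections X Y = {q \<in> X \<rightarrow>\<^sub>E Y. bij_betw q X Y}"

text \<open>
  Row and column sets are kept separate, so that minors of \<open>f\<close> are again of the form \<open>per X Y f\<close>.
\<close>

definition per :: "'a set \<Rightarrow> 'b set \<Rightarrow> ('a \<Rightarrow> 'b \<Rightarrow> 'c) \<Rightarrow> 'c::comm_ring_1" where
  "per X Y f = (\<Sum>q\<in>bijections X Y. \<Prod>x\<in>X. f x (q x))"

lemma finite_bijections: "finite X \<Longrightarrow> finite Y \<Longrightarrow> finite (bijections X Y)"
  unfolding bijections_def by (auto intro!: finite_PiE)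

text \<open>A function that \<open>permutes\<close> is the identity outside the index set, whereas a
  member of \<open>bijections\<close> is undefined there. Restriction and extension by the identity
  are mutually inverse and keep each product.\<close>

lemma permanent_eq_per:
  assumes "M \<in> carrier_mat n n"
  shows "permanent M = per {..<n} {..<n} (\<lambda>i j. M $$ (i, j))"
proof -
  have "(\<Sum>p | p permutes {..<n}. \<Prod>i<n. M $$ (i, p i)) =
      (\<Sum>q\<in>bijections {..<n} {..<n}. \<Prod>i<n. M $$ (i, q i))"
  proof (rule sum.reindex_bij_witness[where
        i = "\<lambda>q i. if i < n then q i else i" and j = "\<lambda>p. restrict p {..<n}"])
    fix p assume p: "p \<in> {p. p permutes {..<n}}"
    then have "bij_betw p {..<n} {..<n}" by (simp add: permutes_imp_bij)
    then show "restrict p {..<n} \<in> bijections {..<n} {..<n}"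
      using bij_betw_imp_funcset[of p "{..<n}" "{..<n}"]
      by (auto simp: bijections_def bij_betw_restrict_eq)
    show "(\<lambda>i. if i < n then restrict p {..<n} i else i) = p"
      using p by (auto simp: permutes_def)
  next
    fix q assume q: "q \<in> bijections {..<n} {..<n}"
    then show "restrict (\<lambda>i. if i < n then q i else i) {..<n} = q"
      by (auto simp: bijections_def fun_eq_iff PiE_def extensional_def)
    have "bij_betw q {..<n} {..<n}" using q by (simp add: bijections_def)
    then have "bij_betw (\<lambda>i. if i < n then q i else i) {..<n} {..<n}"
      by (rule iffD1[OF bij_betw_cong, rotated]) auto
    then have "(\<lambda>i. if i < n then q i else i) permutes {..<n}"
      by (rule bij_imp_permutes) auto
    then show "(\<lambda>i. if i < n then q i else i) \<in> {p. p permutes {..<n}}" by simp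
  qed (auto intro!: prod.cong)
  then show ?thesis
    using assms by (simp add: permanent_def per_def lessThan_atLeast0)
qed

lemma per_cong:
  assumes "\<And>x y. x \<in> X \<Longrightarrow> y \<in> Y \<Longrightarrow> f x y = g x y"
  shows "per X Y f = per X Y g"
  unfolding per_def using assms by (intro sum.cong prod.cong) (auto simp: bijections_def)

lemma per_empty: "per {} Y f = (if Y = {} then 1 else 0)"
proof -
  have eq: "bijections {} Y = (if Y = {} then {\<lambda>x. undefined} else {})"
    by (auto simp: bijections_def bij_betw_def)
  show ?thesis unfolding per_def eq by simp
qed

lemma per_zero_column:
  assumes "finite X" "y \<in> Y" "\<And>x. x \<in> X \<Longrightarrow> f x y = 0"
  shows "per X Y f = 0"
  unfolding per_def
proof (rule sum.neutral, rule ballI)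
  fix q assume "q \<in> bijections X Y"
  then obtain x where "x \<in> X" "q x = y"
    using assms(2) by (auto simp: bijections_def bij_betw_def)
  then show "(\<Prod>x\<in>X. f x (q x)) = 0"
    using assms by (metis prod_zero)
qed

text \<open>The bijections sending \<open>x\<close> to \<open>y\<close> correspond, by restriction
  and by update at \<open>x\<close>, to the bijections of the minor. No signs occur, so the index
  sets need no order.\<close>

lemma per_laplace:
  assumes fin: "finite X" "finite Y" and x: "x \<in> X"
  shows "per X Y f = (\<Sum>y\<in>Y. f x y * per (X - {x}) (Y - {y}) f)"
proof -
  have "(\<Sum>y\<in>Y. f x y * per (X - {x}) (Y - {y}) f) =
      (\<Sum>(y, q)\<in>Sigma Y (\<lambda>y. bijections (X - {x}) (Y - {y})).
         f x y * (\<Prod>z\<in>X - {x}. f z (q z)))"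
    using fin by (simp add: per_def sum_distrib_left sum.Sigma finite_bijections)
  also have "\<dots> = (\<Sum>q\<in>bijections X Y. \<Prod>z\<in>X. f z (q z))"
  proof (rule sum.reindex_bij_witness[where
        j = "\<lambda>(y, q). q(x := y)" and i = "\<lambda>q. (q x, restrict q (X - {x}))"])
    fix a assume a: "a \<in> Sigma Y (\<lambda>y. bijections (X - {x}) (Y - {y}))"
    obtain y q where aq: "a = (y, q)" by force
    have y: "y \<in> Y" and q: "bij_betw q (X - {x}) (Y - {y})"
      and e: "q \<in> (X - {x}) \<rightarrow>\<^sub>E (Y - {y})"
      using a by (auto simp: aq bijections_def)
    have "bij_betw (q(x := y)) (X - {x}) (Y - {y})"
      using q by (rule iffD1[OF bij_betw_cong, rotated]) auto
    then have "bij_betw (q(x := y)) (insert x (X - {x})) (insert y (Y - {y}))"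
      using notIn_Un_bij_betw[of x "X - {x}" "q(x := y)" "Y - {y}"] by simp
    then have "bij_betw (q(x := y)) X Y"
      using x y by (simp add: insert_absorb)
    moreover have "q(x := y) \<in> X \<rightarrow>\<^sub>E Y"
      using e x y by (auto simp: PiE_def extensional_def Pi_def)
    ultimately show "(case a of (y, q) \<Rightarrow> q(x := y)) \<in> bijections X Y"
      by (simp add: aq bijections_def)
    show "((case a of (y, q) \<Rightarrow> q(x := y)) x,
           restrict (case a of (y, q) \<Rightarrow> q(x := y)) (X - {x})) = a"
      using e by (auto simp: aq fun_eq_iff PiE_def extensional_def)
    show "(\<Prod>z\<in>X. f z ((case a of (y, q) \<Rightarrow> q(x := y)) z)) =
        (case a of (y, q) \<Rightarrow> f x y * (\<Prod>z\<in>X - {x}. f z (q z)))"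
      using fin x by (simp add: aq prod.remove[of X x])
  next
    fix q assume q: "q \<in> bijections X Y"
    have b: "bij_betw q X Y" and e: "q \<in> X \<rightarrow>\<^sub>E Y"
      using q by (auto simp: bijections_def)
    show "(case (q x, restrict q (X - {x})) of (y, q) \<Rightarrow> q(x := y)) = q"
      using e x by (auto simp: fun_eq_iff PiE_def extensional_def)
    have "bij_betw q (X - {x}) (Y - {q x})"
      using b x by (auto simp: bij_betw_def inj_on_def)
    then have "restrict q (X - {x}) \<in> bijections (X - {x}) (Y - {q x})"
      using bij_betw_imp_funcset[of q "X - {x}" "Y - {q x}"]
      by (auto simp: bijections_def bij_betw_restrict_eq)
    then show "(q x, restrict q (X - {x})) \<in> Sigma Y (\<lambda>y. bijections (X - {x}) (Y - {y}))"
      using e x by auto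
  qed
  finally show ?thesis by (simp add: per_def)
qed

lemma per_laplace_support:
  assumes "finite X" "finite Y" "x \<in> X" "S \<subseteq> Y" "\<And>y. y \<in> Y - S \<Longrightarrow> f x y = 0"
  shows "per X Y f = (\<Sum>y\<in>S. f x y * per (X - {x}) (Y - {y}) f)"
  unfolding per_laplace[OF assms(1-3)]
  using assms by (intro sum.mono_neutral_right) auto

text \<open>Induction on the rows of the first block: expanding along row \<open>x\<close> only
  involves columns of \<open>Y\<close>, and each minor is again block diagonal. The minors force
  \<open>Y\<close> to vary in the induction.\<close>

lemma per_Un:
  assumes "finite X" "finite X'" "finite Y" "finite Y'" "X \<inter> X' = {}" "Y \<inter> Y' = {}"
    and "\<And>x y. x \<in> X \<Longrightarrow> y \<in> Y' \<Longrightarrow> f x y = 0"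
    and "\<And>x y. x \<in> X' \<Longrightarrow> y \<in> Y \<Longrightarrow> f x y = 0"
  shows "per (X \<union> X') (Y \<union> Y') f = per X Y f * per X' Y' f"
  using assms
proof (induction X arbitrary: Y rule: finite_induct)
  case empty
  show ?case
  proof (cases "Y = {}")
    \<comment> \<open>The blocks need not be square. With no rows left for a column of
      \<open>Y\<close>, that column vanishes on \<open>X'\<close>, so both sides are 0.\<close>
    case False
    then obtain y where "y \<in> Y" by auto
    then have "per X' (Y \<union> Y') f = 0"
      using empty by (intro per_zero_column[where y = y]) auto
    then show ?thesis using False by (simp add: per_empty)
  qed (simp add: per_empty)
next
  case (insert x X)
  have step: "per (X \<union> X') ((Y - {y}) \<union> Y') f = per X (Y - {y}) f * per X' Y' f" for y
    using insert.prems by (intro insert.IH) auto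
  have "insert x X \<union> X' - {x} = X \<union> X'"
    using insert.prems insert.hyps by auto
  moreover have "Y \<union> Y' - {y} = (Y - {y}) \<union> Y'" if "y \<in> Y" for y
    using insert.prems that by auto
  ultimately have "per (insert x X \<union> X') (Y \<union> Y') f =
      (\<Sum>y\<in>Y. f x y * per (X \<union> X') ((Y - {y}) \<union> Y') f)"
    using insert.prems insert.hyps
    by (subst per_laplace_support[where x = x and S = Y]) auto
  also have "\<dots> = (\<Sum>y\<in>Y. f x y * per X (Y - {y}) f) * per X' Y' f"
    by (simp add: step sum_distrib_right mult.assoc)
  also have "(\<Sum>y\<in>Y. f x y * per X (Y - {y}) f) = per (insert x X) Y f"
    using insert.prems insert.hyps by (subst per_laplace[where x = x]) auto
  finally show ?case .
qed

lemma per_image: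
  assumes "finite X" "finite Y" "inj_on h X" "inj_on k Y"
  shows "per (h ` X) (k ` Y) f = per X Y (\<lambda>x y. f (h x) (k y))"
  using assms
proof (induction X arbitrary: Y rule: finite_induct)
  case empty
  then show ?case by (simp add: per_empty)
next
  case (insert x X)
  have "h ` insert x X - {h x} = h ` X"
    using insert.prems insert.hyps by auto
  moreover have "k ` Y - {k y} = k ` (Y - {y})" if "y \<in> Y" for y
    using insert.prems that by (auto simp: inj_on_def)
  moreover have "per (h ` X) (k ` (Y - {y})) f = per X (Y - {y}) (\<lambda>x y. f (h x) (k y))" for y
    using insert.prems by (intro insert.IH) (auto intro: inj_on_subset)
  moreover have "per (h ` insert x X) (k ` Y) f =
      (\<Sum>y\<in>Y. f (h x) (k y) * per (h ` insert x X - {h x}) (k ` Y - {k y}) f)"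
    using insert.prems insert.hyps
    by (subst per_laplace[where x = "h x"]) (auto simp: sum.reindex)
  moreover have "per (insert x X) Y (\<lambda>x y. f (h x) (k y)) =
      (\<Sum>y\<in>Y. f (h x) (k y) * per X (Y - {y}) (\<lambda>x y. f (h x) (k y)))"
    using insert.prems insert.hyps by (subst per_laplace[where x = x]) auto
  ultimately show ?case by simp
qed

section \<open>Tridiagonal permanents and the recurrence of \<open>a_seq\<close>\<close>

text \<open>The permanent version of a continuant; the value 1 at order 0 belongs to the empty
  matrix.\<close>

fun tridiag :: "real \<Rightarrow> real \<Rightarrow> real \<Rightarrow> nat \<Rightarrow> real" where
  "tridiag \<alpha> \<beta> \<gamma> 0 = 1"
| "tridiag \<alpha> \<beta> \<gamma> (Suc 0) = \<beta>"
| "tridiag \<alpha> \<beta> \<gamma> (Suc (Suc k)) = \<beta> * tridiag \<alpha> \<beta> \<gamma> (Suc k) + \<alpha> * \<gamma> * tridiag \<alpha> \<beta> \<gamma> k"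

text \<open>The tridiagonal terms solve the homogeneous recurrence, while \<alpha>^m leaves the
  defect \<alpha>^m - \<beta> \<alpha>^(m-1) - \<alpha> \<gamma> \<alpha>^(m-2) = \<alpha>^(m-1)
  (\<alpha> - \<beta> - \<gamma>), and \<gamma>^m likewise. The shift by 3 avoids truncated
  subtraction.\<close>

lemma a_seq_eq_tridiag:
  "a_seq \<alpha> \<beta> \<gamma> (m + 3) =
    \<beta> * tridiag \<alpha> \<beta> \<gamma> (m + 2) + 2 * \<alpha> * \<gamma> * tridiag \<alpha> \<beta> \<gamma> (m + 1) + \<alpha> ^ (m + 3) + \<gamma> ^ (m + 3)"
proof (induction m rule: less_induct)
  case (less m)
  consider "m = 0" | "m = 1" | k where "m = Suc (Suc k)"
    by (metis One_nat_def not0_implies_Suc)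
  then show ?case
  proof cases
    case 1
    then show ?thesis
      by (subst a_seq.simps) (simp add: numeral_eq_Suc algebra_simps)
  next
    case 2
    then show ?thesis
      by (subst a_seq.simps) (simp add: numeral_eq_Suc algebra_simps)
  next
    case (3 k)
    have "a_seq \<alpha> \<beta> \<gamma> (m + 3) = \<beta> * a_seq \<alpha> \<beta> \<gamma> (Suc k + 3) + \<alpha> * \<gamma> * a_seq \<alpha> \<beta> \<gamma> (k + 3)
        + \<alpha> ^ (k + 4) * (\<alpha> - \<beta> - \<gamma>) + \<gamma> ^ (k + 4) * (\<gamma> - \<beta> - \<alpha>)"
      using 3 by (subst a_seq.simps) (simp add: numeral_eq_Suc)
    then show ?thesis
      using less.IH[of "Suc k"] less.IH[of k] 3
      by (simp add: numeral_eq_Suc algebra_simps)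
  qed
qed

text \<open>Expansion along the last row. Entries are prescribed only below \<open>k\<close>, so the
  induction hypothesis applies to leading blocks of the same \<open>f\<close>.\<close>

lemma per_tridiag:
  assumes "\<And>i j. i < k \<Longrightarrow> j < k \<Longrightarrow> f i j =
    (if i = j then \<beta> else if j = Suc i then \<gamma> else if i = Suc j then \<alpha> else 0)"
  shows "per {..<k} {..<k} f = tridiag \<alpha> \<beta> \<gamma> k"
  using assms
proof (induction k rule: less_induct)
  case (less k)
  consider "k = 0" | "k = 1" | l where "k = Suc (Suc l)"
    by (metis One_nat_def not0_implies_Suc)
  then show ?case
  proof cases
    case 1
    then show ?thesis by (simp add: per_empty)
  next
    case 2
    have "{..<1::nat} = {0}" by auto
    then show ?thesis
      using less.prems 2 by (subst per_laplace[where x = 0]) (auto simp: per_empty)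
  next
    case (3 l)
    note f = less.prems[unfolded 3]
    have T1: "per {..<Suc l} {..<Suc l} f = tridiag \<alpha> \<beta> \<gamma> (Suc l)"
      using less.IH[of "Suc l"] f 3 by simp
    have T0: "per {..<l} {..<l} f = tridiag \<alpha> \<beta> \<gamma> l"
      using less.IH[of l] f 3 by simp
    \<comment> \<open>Here the last row and column \<open>l\<close> are gone, so column
      \<open>Suc l\<close> is nonzero only in row \<open>l\<close>, where it holds \<gamma>.
      Choosing another column in row \<open>l\<close> therefore leaves a zero column.\<close>
    have side: "per {..<Suc l} ({..<Suc (Suc l)} - {l}) f = \<gamma> * tridiag \<alpha> \<beta> \<gamma> l"
    proof -
      have zero: "per {..<l} ({..<Suc (Suc l)} - {l} - {y}) f = 0" if "y < l" for y
        using that f by (intro per_zero_column[where y = "Suc l"]) auto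
      have "per {..<Suc l} ({..<Suc (Suc l)} - {l}) f =
          (\<Sum>y\<in>{..<Suc (Suc l)} - {l}. f l y * per {..<l} ({..<Suc (Suc l)} - {l} - {y}) f)"
        by (subst per_laplace[where x = l]) (auto simp: lessThan_Suc)
      also have "\<dots> = (\<Sum>y\<in>{Suc l}. f l y * per {..<l} ({..<Suc (Suc l)} - {l} - {y}) f)"
        using zero by (intro sum.mono_neutral_right) (auto simp: less_Suc_eq)
      finally have "per {..<Suc l} ({..<Suc (Suc l)} - {l}) f =
          f l (Suc l) * per {..<l} ({..<Suc (Suc l)} - {l} - {Suc l}) f" by simp
      moreover have "{..<Suc (Suc l)} - {l} - {Suc l} = {..<l}" by auto
      ultimately show ?thesis using f T0 by simp
    qed
    have eq: "{..<Suc (Suc l)} - {Suc l} = {..<Suc l}" by auto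
    have "per {..<Suc (Suc l)} {..<Suc (Suc l)} f =
        (\<Sum>y\<in>{Suc l, l}. f (Suc l) y * per ({..<Suc (Suc l)} - {Suc l}) ({..<Suc (Suc l)} - {y}) f)"
      using f by (intro per_laplace_support) auto
    then show ?thesis
      using 3 f T1 side by (simp add: eq)
  qed
qed

section \<open>The permanent of a single cycle\<close>

text \<open>
  Entry \<open>(i, j)\<close> of \<open>\<alpha> S\<^sup>-\<^sup>1 + \<beta> I + \<gamma> S\<close>. The order of the cases is immaterial because the
  supports are disjoint when \<open>p\<close> has no cycles of length 1 or 2.
\<close>

definition weight :: "real \<Rightarrow> real \<Rightarrow> real \<Rightarrow> ('a \<Rightarrow> 'a) \<Rightarrow> 'a \<Rightarrow> 'a \<Rightarrow> real" where
  "weight \<alpha> \<beta> \<gamma> p i j =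
    (if i = j then \<beta> else if j = p i then \<gamma> else if i = p j then \<alpha> else 0)"

lemma weight_cyclic:
  assumes "i < m" "j < m"
  shows "weight \<alpha> \<beta> \<gamma> (\<lambda>i. Suc i mod m) i j =
    (if i = j then \<beta> else if j = Suc i \<or> Suc i = m \<and> j = 0 then \<gamma>
     else if i = Suc j \<or> Suc j = m \<and> i = 0 then \<alpha> else 0)"
  using assms by (auto simp: weight_def mod_Suc)

text \<open>The last row holds \<alpha>, \<beta> and the corner entry \<gamma>. The minor of \<beta>
  is tridiagonal; each of the other two minors has one more corner and splits into a triangular
  part, giving a pure power, and a tridiagonal part.\<close>

lemma per_weight_cyclic:
  assumes "m \<ge> 3"
  shows "per {..<m} {..<m} (weight \<alpha> \<beta> \<gamma> (\<lambda>i. Suc i mod m)) = a_seq \<alpha> \<beta> \<gamma> m"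
proof -
  obtain l where m: "m = l + 3" using assms by (metis add.commute le_Suc_ex)
  define f where "f = weight \<alpha> \<beta> \<gamma> (\<lambda>i. Suc i mod m)"
  have f: "f i j = (if i = j then \<beta> else if j = Suc i \<or> i = l + 2 \<and> j = 0 then \<gamma>
      else if i = Suc j \<or> j = l + 2 \<and> i = 0 then \<alpha> else 0)" if "i < m" "j < m" for i j
    using weight_cyclic[OF that] by (simp add: f_def m)
  have T2: "per {..<l + 2} {..<l + 2} f = tridiag \<alpha> \<beta> \<gamma> (l + 2)"
    using f by (intro per_tridiag) (auto simp: m)
  have T1: "per {..<l + 1} {..<l + 1} f = tridiag \<alpha> \<beta> \<gamma> (l + 1)"
    using f by (intro per_tridiag) (auto simp: m)
  have T1': "per (Suc ` {..<l + 1}) (Suc ` {..<l + 1}) f = tridiag \<alpha> \<beta> \<gamma> (l + 1)"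
    using f by (subst per_image) (auto intro!: per_tridiag simp: m)
  \<comment> \<open>With columns shifted by one against the rows, the block is lower triangular with
    diagonal \<gamma>. The bound on \<open>k\<close> excludes row 0, whose corner entry lies in
    column \<open>l + 2\<close>.\<close>
  have upper: "per {l + 2 - k..<l + 2} (Suc ` {l + 2 - k..<l + 2}) f = \<gamma> ^ k" if "k \<le> l + 1" for k
    using that
  proof (induction k)
    case 0
    then show ?case by (simp add: per_empty)
  next
    case (Suc k)
    let ?i = "l + 2 - Suc k"
    have "per {?i..<l + 2} (Suc ` {?i..<l + 2}) f =
        (\<Sum>y\<in>{Suc ?i}. f ?i y * per ({?i..<l + 2} - {?i}) (Suc ` {?i..<l + 2} - {y}) f)"
      using f Suc.prems by (intro per_laplace_support) (auto simp: m)
    moreover have "{?i..<l + 2} - {?i} = {l + 2 - k..<l + 2}"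
      "Suc ` {?i..<l + 2} - {Suc ?i} = Suc ` {l + 2 - k..<l + 2}"
      using Suc.prems by auto
    ultimately show ?case
      using Suc f[of ?i "Suc ?i"] by (simp add: m)
  qed
  \<comment> \<open>Row \<open>k\<close> can only use \<alpha> in column \<open>k - 1\<close>, and
    so on down to row 0, which uses the corner \<alpha> in column \<open>l + 2\<close>. The bound on
    \<open>k\<close> excludes row \<open>l + 1\<close>, which has \<gamma> in that column.\<close>
  have lower: "per {..<Suc k} (insert (l + 2) {..<k}) f = \<alpha> ^ Suc k" if "k \<le> l" for k
    using that
  proof (induction k)
    case 0
    have "{..<1::nat} = {0}" by auto
    then show ?case
      using f by (subst per_laplace[where x = 0]) (auto simp: per_empty m)
  next
    case (Suc k)
    have "per {..<Suc (Suc k)} (insert (l + 2) {..<Suc k}) f =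
        (\<Sum>y\<in>{k}. f (Suc k) y * per ({..<Suc (Suc k)} - {Suc k}) (insert (l + 2) {..<Suc k} - {y}) f)"
      using f Suc.prems by (intro per_laplace_support) (auto simp: m)
    moreover have "{..<Suc (Suc k)} - {Suc k} = {..<Suc k}"
      "insert (l + 2) {..<Suc k} - {k} = insert (l + 2) {..<k}"
      using Suc.prems by auto
    ultimately show ?case
      using Suc f by (simp add: m)
  qed
  \<comment> \<open>The minor of the corner \<gamma>, expanded along row 0: column 1 leads to
    \<open>upper\<close>, the other corner to a shifted tridiagonal block.\<close>
  have right: "per {..<l + 2} ({..<m} - {0}) f = \<gamma> ^ (l + 2) + \<alpha> * tridiag \<alpha> \<beta> \<gamma> (l + 1)"
  proof -
    have "per {..<l + 2} ({..<m} - {0}) f =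
        (\<Sum>y\<in>{1, l + 2}. f 0 y * per ({..<l + 2} - {0}) ({..<m} - {0} - {y}) f)"
      using f by (intro per_laplace_support) (auto simp: m)
    moreover have "{..<l + 2} - {0} = {l + 2 - (l + 1)..<l + 2}"
      "{..<m} - {0} - {1} = Suc ` {l + 2 - (l + 1)..<l + 2}"
      by (auto simp: m image_Suc_atLeastLessThan)
    moreover have "{l + 2 - (l + 1)..<l + 2} = Suc ` {..<l + 1}"
      "{..<m} - {0} - {l + 2} = Suc ` {..<l + 1}"
      by (auto simp: m lessThan_atLeast0 image_Suc_atLeastLessThan)
    ultimately have "per {..<l + 2} ({..<m} - {0}) f = \<gamma> * \<gamma> ^ (l + 1) + \<alpha> * tridiag \<alpha> \<beta> \<gamma> (l + 1)"
      using f[of 0 1] f[of 0 "l + 2"] upper[of "l + 1"] T1' by (simp only: m) simp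
    then show ?thesis by simp
  qed
  \<comment> \<open>The minor of \<alpha>, expanded along row \<open>l + 1\<close>: column
    \<open>l\<close> leads to \<open>lower\<close>, column \<open>l + 2\<close> to a leading
    tridiagonal block.\<close>
  have left: "per {..<l + 2} ({..<m} - {l + 1}) f = \<alpha> ^ (l + 2) + \<gamma> * tridiag \<alpha> \<beta> \<gamma> (l + 1)"
  proof -
    have "per {..<l + 2} ({..<m} - {l + 1}) f =
        (\<Sum>y\<in>{l, l + 2}. f (l + 1) y * per ({..<l + 2} - {l + 1}) ({..<m} - {l + 1} - {y}) f)"
      using f by (intro per_laplace_support) (auto simp: m)
    moreover have "{..<l + 2} - {l + 1} = {..<Suc l}"
      "{..<m} - {l + 1} - {l} = insert (l + 2) {..<l}"
      "{..<m} - {l + 1} - {l + 2} = {..<Suc l}"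
      by (auto simp: m)
    ultimately show ?thesis
      using f lower[of l] T1 by (simp add: m)
  qed
  have "per {..<m} {..<m} f =
      (\<Sum>y\<in>{l + 2, 0, l + 1}. f (l + 2) y * per ({..<m} - {l + 2}) ({..<m} - {y}) f)"
    using f by (intro per_laplace_support) (auto simp: m)
  moreover have "{..<m} - {l + 2} = {..<l + 2}" by (auto simp: m)
  ultimately have "per {..<m} {..<m} f = a_seq \<alpha> \<beta> \<gamma> (l + 3)"
    using f T2 left right unfolding a_seq_eq_tridiag
    by (simp add: m algebra_simps numeral_eq_Suc)
  then show ?thesis by (simp add: f_def m)
qed

section \<open>Splitting a permutation into cycles and building one from a partition\<close>

text \<open>\<open>weight\<close> only compares points for equality, so the injective enumeration
  \<open>h\<close> of the cycle transports it to the standard cyclic matrix.\<close>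

lemma per_weight_cycle:
  assumes "m \<ge> 3" "bij_betw h {..<m} Y" "\<And>k. k < m \<Longrightarrow> p (h k) = h (Suc k mod m)"
  shows "per Y Y (weight \<alpha> \<beta> \<gamma> p) = a_seq \<alpha> \<beta> \<gamma> m"
proof -
  have inj: "inj_on h {..<m}" and Y: "Y = h ` {..<m}"
    using assms(2) by (auto simp: bij_betw_def)
  have "weight \<alpha> \<beta> \<gamma> p (h i) (h j) = weight \<alpha> \<beta> \<gamma> (\<lambda>i. Suc i mod m) i j"
    if "i < m" "j < m" for i j
  proof -
    have "h a = h b \<longleftrightarrow> a = b" if "a < m" "b < m" for a b
      using inj that by (auto simp: inj_on_def)
    then show ?thesis using that assms by (simp add: weight_def)
  qed
  then have "per Y Y (weight \<alpha> \<beta> \<gamma> p) =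
      per {..<m} {..<m} (weight \<alpha> \<beta> \<gamma> (\<lambda>i. Suc i mod m))"
    unfolding Y using inj by (subst per_image) (auto intro!: per_cong)
  then show ?thesis using per_weight_cyclic[OF assms(1)] by simp
qed

text \<open>An off-diagonal nonzero entry joins a point to its image under \<open>p\<close>, so two
  sets closed under \<open>p\<close> do not interact.\<close>

lemma per_weight_Un:
  assumes "finite Y" "finite Z" "Y \<inter> Z = {}" "p ` Y \<subseteq> Y" "p ` Z \<subseteq> Z"
  shows "per (Y \<union> Z) (Y \<union> Z) (weight \<alpha> \<beta> \<gamma> p) =
    per Y Y (weight \<alpha> \<beta> \<gamma> p) * per Z Z (weight \<alpha> \<beta> \<gamma> p)"
  using assms by (intro per_Un) (auto simp: weight_def)

text \<open>Finiteness forces two iterates to coincide; cancelling powers of the injective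
  \<open>p\<close> turns this into a return to \<open>x\<close> itself. The least positive return
  time serves as \<open>m\<close>, since an earlier coincidence would give a shorter return.\<close>

lemma orbit_parametrization:
  assumes "finite X" "inj p" "p ` X \<subseteq> X" "x \<in> X"
  obtains m where "m > 0" "inj_on (\<lambda>k. (p ^^ k) x) {..<m}" "(p ^^ m) x = x"
proof -
  have cancel: "(p ^^ (j - i)) x = x" if "(p ^^ i) x = (p ^^ j) x" "i < j" for i j
  proof -
    have "(p ^^ i) ((p ^^ (j - i)) x) = (p ^^ i) x"
      using that by (metis add_diff_inverse_nat comp_apply funpow_add less_imp_not_less)
    then show ?thesis using inj_fn[OF assms(2), of i] by (auto dest: injD)
  qed
  have "(p ^^ k) x \<in> X" for k
    using assms by (induction k) auto
  then have "\<not> inj (\<lambda>k. (p ^^ k) x)"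
    using assms(1) by (metis finite_imageD finite_subset image_subsetI infinite_UNIV_nat)
  then obtain i j where "(p ^^ i) x = (p ^^ j) x" "i < j"
    unfolding inj_on_def by (metis linorder_neqE_nat)
  then have ex: "\<exists>k. k > 0 \<and> (p ^^ k) x = x"
    using cancel by (intro exI[of _ "j - i"]) auto
  define m where "m = (LEAST k. k > 0 \<and> (p ^^ k) x = x)"
  have m: "m > 0" "(p ^^ m) x = x"
    using LeastI_ex[OF ex] by (auto simp: m_def)
  have "(p ^^ i) x \<noteq> (p ^^ j) x" if "i < j" "j < m" for i j
  proof
    assume "(p ^^ i) x = (p ^^ j) x"
    then have "m \<le> j - i"
      using cancel that unfolding m_def by (intro Least_le) auto
    then show False using that by auto
  qed
  then have "inj_on (\<lambda>k. (p ^^ k) x) {..<m}"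
    by (intro linorder_inj_onI) auto
  then show thesis using m that by blast
qed

text \<open>The orbit of one point is split off: it contributes one part of the partition and one
  factor \<open>a_seq\<close>, and the induction hypothesis handles its complement.\<close>

lemma per_weight_eq_H:
  assumes "finite X" "inj p" "p ` X = X" "\<And>x. x \<in> X \<Longrightarrow> p x \<noteq> x \<and> p (p x) \<noteq> x"
  shows "\<exists>r \<in> R (card X) 3. per X X (weight \<alpha> \<beta> \<gamma> p) = H \<alpha> \<beta> \<gamma> r"
  using assms
proof (induction X rule: finite_psubset_induct)
  case (psubset X)
  show ?case
  proof (cases "X = {}")
    case True
    then show ?thesis
      by (intro bexI[of _ "{#}"]) (auto simp: per_empty H_def R_def)
  next
    case False
    then obtain x where x: "x \<in> X" by auto
    obtain m where m: "m > 0" "inj_on (\<lambda>k. (p ^^ k) x) {..<m}" "(p ^^ m) x = x"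
      using orbit_parametrization[of X p x] psubset x by blast
    define h where "h = (\<lambda>k. (p ^^ k) x)"
    define Y where "Y = h ` {..<m}"
    have ph: "p (h k) = h (Suc k mod m)" if "k < m" for k
      using m that by (auto simp: h_def mod_Suc)
    have bij: "bij_betw h {..<m} Y"
      using m by (simp add: h_def Y_def bij_betw_def)
    have "m \<noteq> 1" "m \<noteq> 2"
      using m(3) psubset.prems(3)[OF x] by (auto simp: numeral_eq_Suc)
    then have m3: "m \<ge> 3" using m by linarith
    have "(p ^^ k) x \<in> X" for k
      using psubset.prems(2) x by (induction k) auto
    then have YX: "Y \<subseteq> X" by (auto simp: Y_def h_def)
    have finY: "finite Y" and cardY: "card Y = m"
      using bij bij_betw_finite bij_betw_same_card by fastforce+
    have pY: "p ` Y \<subseteq> Y"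
      using ph m by (auto simp: Y_def)
    then have "p ` Y = Y"
      using finY psubset.prems(1) by (meson endo_inj_surj inj_on_subset subset_UNIV)
    \<comment> \<open>Since \<open>p\<close> is injective, the complement of the orbit is mapped
      onto itself as well.\<close>
    then have pZ: "p ` (X - Y) = X - Y"
      using psubset.prems by (simp add: image_set_diff)
    have "x \<in> Y" using m by (auto simp: Y_def h_def intro: image_eqI[of _ _ 0])
    then have "X - Y \<subset> X" using x by auto
    then obtain r where r: "r \<in> R (card (X - Y)) 3"
      "per (X - Y) (X - Y) (weight \<alpha> \<beta> \<gamma> p) = H \<alpha> \<beta> \<gamma> r"
      using psubset.IH[of "X - Y"] psubset.prems pZ by auto
    have "per (Y \<union> (X - Y)) (Y \<union> (X - Y)) (weight \<alpha> \<beta> \<gamma> p) = a_seq \<alpha> \<beta> \<gamma> m * H \<alpha> \<beta> \<gamma> r"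
      using finY psubset.hyps pY pZ r(2) per_weight_cycle[OF m3 bij ph]
      by (subst per_weight_Un) auto
    moreover have "Y \<union> (X - Y) = X" using YX by auto
    moreover have "card X = m + card (X - Y)"
      using YX finY cardY psubset.hyps by (metis card_Diff_subset card_mono le_add_diff_inverse)
    ultimately show ?thesis
      using r m3 by (intro bexI[of _ "add_mset m r"]) (auto simp: H_def R_def)
  qed
qed

text \<open>For each part \<open>m\<close>, a set of \<open>m\<close> points is reserved and rotated
  cyclically, while the remaining points carry the permutation given by the induction
  hypothesis.\<close>

lemma exists_weight_of_partition:
  assumes "finite X" "r \<in> R (card X) 3"
  shows "\<exists>p. bij_betw p X X \<and> (\<forall>x\<in>X. p x \<noteq> x \<and> p (p x) \<noteq> x) \<and>
    per X X (weight \<alpha> \<beta> \<gamma> p) = H \<alpha> \<beta> \<gamma> r"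
  using assms
proof (induction r arbitrary: X)
  case empty
  then show ?case by (auto simp: R_def H_def per_empty)
next
  case (add m r)
  then have m3: "m \<ge> 3" and r: "\<forall>k\<in>#r. 3 \<le> k" and card: "card X = m + sum_mset r"
    by (auto simp: R_def)
  obtain Y where Y: "Y \<subseteq> X" "card Y = m" "finite Y"
    using card obtain_subset_with_card_n[of m X] by auto
  have cardZ: "card (X - Y) = sum_mset r"
    using Y card by (simp add: card_Diff_subset)
  obtain q where q: "bij_betw q (X - Y) (X - Y)" "\<forall>x\<in>X - Y. q x \<noteq> x \<and> q (q x) \<noteq> x"
    "per (X - Y) (X - Y) (weight \<alpha> \<beta> \<gamma> q) = H \<alpha> \<beta> \<gamma> r"
    using add.IH[of "X - Y"] add.prems r cardZ by (auto simp: R_def)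
  obtain h where h: "bij_betw h {..<m} Y"
    using Y by (metis bij_betw_iff_card card_lessThan finite_lessThan)
  \<comment> \<open>\<open>g\<close> recovers the position of a point in the enumeration
    \<open>h\<close> of the new cycle.\<close>
  define g where "g = inv_into {..<m} h"
  have g: "g (h k) = k" if "k < m" for k
    using h that by (simp add: g_def bij_betw_inv_into_left)
  define p where "p = (\<lambda>x. if x \<in> Y then h (Suc (g x) mod m) else q x)"
  have hY: "h k \<in> Y" if "k < m" for k
    using h that by (auto simp: bij_betw_def)
  have ph: "p (h k) = h (Suc k mod m)" if "k < m" for k
    using that hY by (simp add: p_def g)
  have inj: "h a = h b \<longleftrightarrow> a = b" if "a < m" "b < m" for a b
    using h that by (auto simp: bij_betw_def inj_on_def)
  have Yh: "Y = h ` {..<m}" using h by (simp add: bij_betw_def)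
  have pY: "p ` Y \<subseteq> Y" using ph hY m3 by (auto simp: Yh)
  have "inj_on p Y"
  proof (rule inj_onI)
    fix x y assume "x \<in> Y" "y \<in> Y" and eq: "p x = p y"
    then obtain a b where ab: "x = h a" "y = h b" "a < m" "b < m" by (auto simp: Yh)
    then have "Suc a mod m = Suc b mod m" using eq m3 by (simp add: ph inj)
    then show "x = y" using ab by (auto simp: mod_Suc split: if_splits)
  qed
  then have bY: "bij_betw p Y Y"
    using pY Y(3) by (simp add: bij_betw_def endo_inj_surj)
  have bZ: "bij_betw p (X - Y) (X - Y)"
    using q(1) by (rule iffD1[OF bij_betw_cong, rotated]) (auto simp: p_def)
  have XY: "Y \<union> (X - Y) = X" using Y by auto
  have bX: "bij_betw p X X"
    using bij_betw_combine[OF bY bZ] XY by auto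
  have pZ: "p ` (X - Y) \<subseteq> X - Y" using bZ by (simp add: bij_betw_def)
  have eqZ: "p x = q x" if "x \<in> X - Y" for x using that by (simp add: p_def)
  have "p x \<noteq> x \<and> p (p x) \<noteq> x" if "x \<in> X" for x
  proof (cases "x \<in> Y")
    case True
    then obtain k where k: "x = h k" "k < m" by (auto simp: Yh)
    \<comment> \<open>As \<open>m\<close> is at least 3, neither one nor two cyclic steps return to
      the starting index.\<close>
    then show ?thesis using m3 by (auto simp: ph inj mod_Suc split: if_splits)
  next
    case False
    then have "x \<in> X - Y" "p x \<in> X - Y" using that pZ by auto
    then show ?thesis using q(2) by (simp add: eqZ)
  qed
  moreover have "per X X (weight \<alpha> \<beta> \<gamma> p) = H \<alpha> \<beta> \<gamma> (add_mset m r)"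
  proof -
    have "per (X - Y) (X - Y) (weight \<alpha> \<beta> \<gamma> p) = per (X - Y) (X - Y) (weight \<alpha> \<beta> \<gamma> q)"
      by (intro per_cong) (auto simp: weight_def eqZ)
    moreover have "per (Y \<union> (X - Y)) (Y \<union> (X - Y)) (weight \<alpha> \<beta> \<gamma> p) =
        per Y Y (weight \<alpha> \<beta> \<gamma> p) * per (X - Y) (X - Y) (weight \<alpha> \<beta> \<gamma> p)"
      using Y add.prems pY pZ by (intro per_weight_Un) auto
    ultimately show ?thesis
      using q(3) per_weight_cycle[OF m3 h ph] by (simp only: XY H_def) simp
  qed
  ultimately show ?case using bX by blast
qed

section \<open>The matrices of \<open>Lambda_hat\<close> and their permanents\<close>

text \<open>The second matrix is the transpose of the first; it represents the inverse permutation
  without naming an inverse function.\<close>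

lemma permutation_matrix_mat:
  assumes "bij_betw p {..<n} {..<n}"
  shows "permutation_matrix n (mat n n (\<lambda>(i, j). of_bool (j = p i)))"
    and "permutation_matrix n (mat n n (\<lambda>(i, j). of_bool (i = p j)))"
proof -
  have "\<exists>!j. j < n \<and> j = p i" if "i < n" for i
    using assms that by (auto simp: bij_betw_def)
  moreover have "\<exists>!j. j < n \<and> i = p j" if "i < n" for i
    using bij_betw_imp_surj_on[OF assms] bij_betw_imp_inj_on[OF assms] that
    by (auto simp: inj_on_def image_iff set_eq_iff)
  ultimately show "permutation_matrix n (mat n n (\<lambda>(i, j). of_bool (j = p i)))"
    "permutation_matrix n (mat n n (\<lambda>(i, j). of_bool (i = p j)))"
    by (auto simp: permutation_matrix_def cong: conj_cong)
qed

text \<open>The permutation \<open>p\<close> is read off from \<open>C\<close>, and symmetry makes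
  \<open>A\<close> its transpose. Disjointness of \<open>B\<close> and \<open>C\<close> excludes
  fixed points; disjointness of \<open>A\<close> and \<open>C\<close> excludes 2-cycles. Conversely,
  these exclusions make the three supports disjoint.\<close>

lemma Lambda_hat_eq:
  "Lambda_hat n \<alpha> \<beta> \<gamma> = {mat n n (\<lambda>(i, j). weight \<alpha> \<beta> \<gamma> p i j) | p.
     bij_betw p {..<n} {..<n} \<and> (\<forall>i<n. p i \<noteq> i \<and> p (p i) \<noteq> i)}" (is "_ = ?W")
proof
  show "Lambda_hat n \<alpha> \<beta> \<gamma> \<subseteq> ?W"
  proof
    fix M assume "M \<in> Lambda_hat n \<alpha> \<beta> \<gamma>"
    then obtain A B C where M: "M = \<alpha> \<cdot>\<^sub>m A + \<beta> \<cdot>\<^sub>m B + \<gamma> \<cdot>\<^sub>m C" and pl: "placement n A B C"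
      and diag: "\<forall>i<n. B $$ (i, i) = 1"
      and sym: "\<forall>i<n. \<forall>j<n. A $$ (i, j) = 1 \<longleftrightarrow> C $$ (j, i) = 1"
      unfolding Lambda_hat_def by blast
    have perm: "permutation_matrix n A" "permutation_matrix n B" "permutation_matrix n C"
      using pl by (auto simp: placement_def)
    have carr: "A \<in> carrier_mat n n" "B \<in> carrier_mat n n" "C \<in> carrier_mat n n"
      using perm by (auto simp: permutation_matrix_def)
    define p where "p i = (THE j. j < n \<and> C $$ (i, j) = 1)" for i
    have p: "p i < n \<and> C $$ (i, p i) = 1" if "i < n" for i
      using perm(3) that theI'[of "\<lambda>j. j < n \<and> C $$ (i, j) = 1"]
      by (auto simp: p_def permutation_matrix_def)
    have C1: "C $$ (i, j) = 1 \<longleftrightarrow> j = p i" if "i < n" "j < n" for i j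
      using p[OF that(1)] perm(3) that by (auto simp: permutation_matrix_def)
    have C: "C $$ (i, j) = of_bool (j = p i)" if "i < n" "j < n" for i j
      using C1[OF that] perm(3) that by (auto simp: permutation_matrix_def)
    have A: "A $$ (i, j) = of_bool (i = p j)" if "i < n" "j < n" for i j
      using C1[OF that(2,1)] sym perm(1) that by (auto simp: permutation_matrix_def)
    have B: "B $$ (i, j) = of_bool (i = j)" if "i < n" "j < n" for i j
    proof -
      have "\<exists>!j. j < n \<and> B $$ (i, j) = 1" "B $$ (i, j) \<in> {0, 1}"
        using perm(2) that by (auto simp: permutation_matrix_def)
      then show ?thesis using diag that by auto
    qed
    have "inj_on p {..<n}"
    proof (rule inj_onI)
      fix a b assume ab: "a \<in> {..<n}" "b \<in> {..<n}" "p a = p b"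
      then have "\<exists>!i. i < n \<and> C $$ (i, p a) = 1"
        using perm(3) p by (auto simp: permutation_matrix_def)
      moreover have "C $$ (a, p a) = 1" "C $$ (b, p a) = 1"
        using ab p[of a] p[of b] by auto
      ultimately show "a = b" using ab by auto
    qed
    moreover have "p ` {..<n} \<subseteq> {..<n}" using p by auto
    ultimately have "bij_betw p {..<n} {..<n}"
      by (simp add: bij_betw_def endo_inj_surj)
    moreover have np: "p i \<noteq> i \<and> p (p i) \<noteq> i" if "i < n" for i
    proof
      have "B $$ (i, i) = 0 \<or> C $$ (i, i) = 0"
        using pl that by (auto simp: placement_def disjoint_supports_def)
      then show "p i \<noteq> i" using that B C by auto
      have "A $$ (i, p i) = 0 \<or> C $$ (i, p i) = 0"
        using pl that p[OF that] unfolding placement_def disjoint_supports_def by blast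
      then show "p (p i) \<noteq> i" using that A C p by auto
    qed
    moreover have "M = mat n n (\<lambda>(i, j). weight \<alpha> \<beta> \<gamma> p i j)"
    proof (rule eq_matI)
      fix i j
      assume "i < dim_row (mat n n (\<lambda>(i, j). weight \<alpha> \<beta> \<gamma> p i j))"
        "j < dim_col (mat n n (\<lambda>(i, j). weight \<alpha> \<beta> \<gamma> p i j))"
      then have ij: "i < n" "j < n" by auto
      then show "M $$ (i, j) = mat n n (\<lambda>(i, j). weight \<alpha> \<beta> \<gamma> p i j) $$ (i, j)"
        using carr np[of i] np[of j] by (auto simp: M A B C weight_def)
    qed (use carr M in auto)
    ultimately show "M \<in> ?W" by blast
  qed
  show "?W \<subseteq> Lambda_hat n \<alpha> \<beta> \<gamma>"
  proof
    fix M assume "M \<in> ?W"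
    then obtain p where M: "M = mat n n (\<lambda>(i, j). weight \<alpha> \<beta> \<gamma> p i j)"
      and bij: "bij_betw p {..<n} {..<n}" and np: "\<forall>i<n. p i \<noteq> i \<and> p (p i) \<noteq> i"
      by blast
    define A :: "real mat" where "A = mat n n (\<lambda>(i, j). of_bool (i = p j))"
    \<comment> \<open>Writing \<open>id i\<close> exhibits \<open>B\<close> as the matrix of the
      identity permutation, in the form required by \<open>permutation_matrix_mat\<close>.\<close>
    define B :: "real mat" where "B = mat n n (\<lambda>(i, j). of_bool (j = id i))"
    define C :: "real mat" where "C = mat n n (\<lambda>(i, j). of_bool (j = p i))"
    have "permutation_matrix n A" "permutation_matrix n B" "permutation_matrix n C"
      unfolding A_def B_def C_def
      by (rule permutation_matrix_mat[OF bij] permutation_matrix_mat[OF bij_betw_id])+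
    then have "placement n A B C"
      using np by (auto simp: placement_def disjoint_supports_def A_def B_def C_def)
    moreover have "M = \<alpha> \<cdot>\<^sub>m A + \<beta> \<cdot>\<^sub>m B + \<gamma> \<cdot>\<^sub>m C"
      using np by (intro eq_matI) (auto simp: M A_def B_def C_def weight_def)
    moreover have "\<forall>i<n. B $$ (i, i) = 1"
      "\<forall>i<n. \<forall>j<n. A $$ (i, j) = 1 \<longleftrightarrow> C $$ (j, i) = 1"
      by (auto simp: A_def B_def C_def)
    ultimately show "M \<in> Lambda_hat n \<alpha> \<beta> \<gamma>"
      unfolding Lambda_hat_def by blast
  qed
qed

lemma permanent_weight:
  "permanent (mat n n (\<lambda>(i, j). weight \<alpha> \<beta> \<gamma> p i j)) = per {..<n} {..<n} (weight \<alpha> \<beta> \<gamma> p)"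
  by (subst permanent_eq_per[of _ n]) (auto intro: per_cong)

theorem theorem3:
  fixes \<alpha> \<beta> \<gamma> :: real and n :: nat
  assumes "\<alpha> \<noteq> 0" and "\<beta> \<noteq> 0" and "\<gamma> \<noteq> 0" and "n \<ge> 3"
  shows "ps (Lambda_hat n \<alpha> \<beta> \<gamma>) = {H \<alpha> \<beta> \<gamma> r | r. r \<in> R n 3}"
proof
  show "ps (Lambda_hat n \<alpha> \<beta> \<gamma>) \<subseteq> {H \<alpha> \<beta> \<gamma> r | r. r \<in> R n 3}"
  proof
    fix v assume "v \<in> ps (Lambda_hat n \<alpha> \<beta> \<gamma>)"
    then obtain p where v: "v = per {..<n} {..<n} (weight \<alpha> \<beta> \<gamma> p)"
      and bij: "bij_betw p {..<n} {..<n}" and np: "\<forall>i<n. p i \<noteq> i \<and> p (p i) \<noteq> i"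
      by (auto simp: ps_def Lambda_hat_eq permanent_weight)
    \<comment> \<open>\<open>per_weight_eq_H\<close> asks for injectivity on the whole type, so
      \<open>p\<close> is replaced by the identity from \<open>n\<close> on; the entries below
      \<open>n\<close> do not change.\<close>
    define q where "q i = (if i < n then p i else i)" for i
    have lt: "p i < n" if "i < n" for i
      using bij that by (auto simp: bij_betw_def)
    have "bij_betw q {..<n} {..<n}"
      using bij by (rule iffD1[OF bij_betw_cong, rotated]) (auto simp: q_def)
    then have "q permutes {..<n}"
      by (rule bij_imp_permutes) (auto simp: q_def)
    then have "inj q" "q ` {..<n} = {..<n}"
      by (simp_all add: permutes_inj permutes_image)
    then obtain r where "r \<in> R (card {..<n}) 3" "per {..<n} {..<n} (weight \<alpha> \<beta> \<gamma> q) = H \<alpha> \<beta> \<gamma> r"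
      using per_weight_eq_H[of "{..<n}" q \<alpha> \<beta> \<gamma>] np lt by (auto simp: q_def)
    moreover have "per {..<n} {..<n} (weight \<alpha> \<beta> \<gamma> q) = v"
      unfolding v by (intro per_cong) (auto simp: weight_def q_def)
    ultimately show "v \<in> {H \<alpha> \<beta> \<gamma> r | r. r \<in> R n 3}" by auto
  qed
  show "{H \<alpha> \<beta> \<gamma> r | r. r \<in> R n 3} \<subseteq> ps (Lambda_hat n \<alpha> \<beta> \<gamma>)"
  proof
    fix v assume "v \<in> {H \<alpha> \<beta> \<gamma> r | r. r \<in> R n 3}"
    then obtain r where r: "v = H \<alpha> \<beta> \<gamma> r" "r \<in> R (card {..<n}) 3" by auto
    then obtain p where "bij_betw p {..<n} {..<n}" "\<forall>i<n. p i \<noteq> i \<and> p (p i) \<noteq> i"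
      and v: "v = permanent (mat n n (\<lambda>(i, j). weight \<alpha> \<beta> \<gamma> p i j))"
      using exists_weight_of_partition[of "{..<n}" r \<alpha> \<beta> \<gamma>]
      by (auto simp: permanent_weight)
    then have "mat n n (\<lambda>(i, j). weight \<alpha> \<beta> \<gamma> p i j) \<in> Lambda_hat n \<alpha> \<beta> \<gamma>"
      unfolding Lambda_hat_eq by blast
    then show "v \<in> ps (Lambda_hat n \<alpha> \<beta> \<gamma>)"
      unfolding ps_def v by blast
  qed
qed

end
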